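(* Let $W_1$ and $W_2$ be finite collections of free ultrafilters on $\mathbb{N}$ such that $\cap W_1=\cap W_2$. Then $W_1=W_2$.
   Context: Filters on $\mathbb{N}$ are proper (do not contain $\emptyset$); a filter is free if it contains every subset of $\mathbb{N}$ with finite complement; an ultrafilter is a maximal filter. For a collection $W$ of filters, $\cap W=\{B\subset\mathbb{N} : B\in\mathfrak{U}\ \text{for all}\ \mathfrak{U}\in W\}$. *)

theory Defs
  imports Main
begin

text \<open>
  A filter in the sense of the paper (a family of subsets that does not contain the empty set)
  is a library filter other than \<open>bot\<close>, viewed through its family of member sets.
  The library's order on filters is the reverse of inclusion of these families,
  so inclusion is written out explicitly below.
\<close>

definition filter_sets :: "'a filter \<Rightarrow> 'a set set" where
  "filter_sets F = {B. eventually (\<lambda>x. x \<in> B) F}"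

definition proper_filter :: "'a filter \<Rightarrow> bool" where
  "proper_filter F \<longleftrightarrow> {} \<notin> filter_sets F"

definition free_filter :: "'a filter \<Rightarrow> bool" where
  "free_filter F \<longleftrightarrow> proper_filter F \<and> (\<forall>B. finite (- B) \<longrightarrow> B \<in> filter_sets F)"

definition ultrafilter :: "'a filter \<Rightarrow> bool" where
  "ultrafilter F \<longleftrightarrow> proper_filter F \<and>
     (\<forall>G. proper_filter G \<longrightarrow> filter_sets F \<subseteq> filter_sets G \<longrightarrow> G = F)"

definition inter_filters :: "'a filter set \<Rightarrow> 'a set set" where
  "inter_filters W = {B. \<forall>U\<in>W. B \<in> filter_sets U}"

end

theory Submission
  imports Defs
begin

text \<open>
  The point is that an ultrafilter cannot contain all the sets common to finitely many
  ultrafilters unless it is one of them. If \<open>U\<close> is a proper filter and \<open>W\<close> is a finite set of ultrafilters without \<open>U\<close>, then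
  by maximality every \<open>V \<in> W\<close> contains a set \<open>A V\<close> outside \<open>U\<close>. The union of these finitely many
  sets lies in every member of \<open>W\<close>, yet not in \<open>U\<close> when \<open>U\<close> is an ultrafilter, because then
  \<open>U\<close> contains all the complements \<open>- A V\<close>, hence also their finite intersection. So
  \<open>inter_filters W \<subseteq> filter_sets U\<close> forces \<open>U \<in> W\<close>
  (lemma \<open>mem_of_inter_filters_subset\<close>), and the theorem is this fact applied in both directions.
\<close>

lemma ultrafilter_Compl_mem:
  assumes "ultrafilter U" and "A \<notin> filter_sets U"
  shows "- A \<in> filter_sets U"
proof -
  \<comment> \<open>Adjoining \<open>- A\<close> keeps the filter proper: otherwise some member of \<open>U\<close> misses \<open>- A\<close>,
    and then \<open>A\<close> itself belongs to \<open>U\<close>. Maximality thus makes the extension equal to \<open>U\<close>.\<close>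
  let ?G = "inf U (principal (- A))"
  have "proper_filter ?G"
    using assms(2) by (simp add: proper_filter_def filter_sets_def eventually_inf_principal)
  moreover have "filter_sets U \<subseteq> filter_sets ?G"
    by (auto simp: filter_sets_def eventually_inf_principal elim: eventually_mono)
  ultimately have "?G = U"
    using assms(1) by (simp add: ultrafilter_def)
  moreover have "- A \<in> filter_sets ?G"
    by (simp add: filter_sets_def eventually_inf_principal)
  ultimately show ?thesis by simp
qed

lemma mem_of_inter_filters_subset:
  assumes "finite W" and "\<forall>V\<in>W. ultrafilter V" and "ultrafilter U"
    and sub: "inter_filters W \<subseteq> filter_sets U"
  shows "U \<in> W"
proof (rule ccontr)
  assume "U \<notin> W"
  have "\<exists>A. A \<in> filter_sets V \<and> A \<notin> filter_sets U" if "V \<in> W" for V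
    using that \<open>U \<notin> W\<close> assms(2,3) unfolding ultrafilter_def by blast
  then obtain A where A: "\<And>V. V \<in> W \<Longrightarrow> A V \<in> filter_sets V"
    "\<And>V. V \<in> W \<Longrightarrow> A V \<notin> filter_sets U"
    by metis
  have "(\<Union>V\<in>W. A V) \<in> inter_filters W"
    unfolding inter_filters_def filter_sets_def
  proof (intro CollectI ballI)
    fix V assume "V \<in> W"
    then have "eventually (\<lambda>x. x \<in> A V) V"
      using A(1) by (simp add: filter_sets_def)
    then show "eventually (\<lambda>x. x \<in> (\<Union>V\<in>W. A V)) V"
      by (rule eventually_mono) (use \<open>V \<in> W\<close> in blast)
  qed
  with sub have un: "eventually (\<lambda>x. x \<in> (\<Union>V\<in>W. A V)) U"
    by (auto simp: filter_sets_def)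
  have "\<forall>V\<in>W. eventually (\<lambda>x. x \<in> - A V) U"
    using ultrafilter_Compl_mem[OF assms(3) A(2)] by (simp add: filter_sets_def)
  then have "eventually (\<lambda>x. \<forall>V\<in>W. x \<in> - A V) U"
    by (rule eventually_ball_finite[OF assms(1)])
  with un have "eventually (\<lambda>x. x \<in> {}) U"
    by eventually_elim auto
  with assms(3) show False
    by (simp add: ultrafilter_def proper_filter_def filter_sets_def)
qed

theorem theorem3p7:
  fixes W1 W2 :: "nat filter set"
  assumes "finite W1" and "finite W2"
    and "\<forall>U\<in>W1. free_filter U \<and> ultrafilter U"
    and "\<forall>U\<in>W2. free_filter U \<and> ultrafilter U"
    and "inter_filters W1 = inter_filters W2"
  shows "W1 = W2"
proof
  have inter_sub: "inter_filters W \<subseteq> filter_sets U" if "U \<in> W" for U :: "nat filter" and W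
    using that by (auto simp: inter_filters_def)
  show "W1 \<subseteq> W2"
    using mem_of_inter_filters_subset[OF assms(2)] inter_sub[of _ W1] assms(3-5) by auto
  show "W2 \<subseteq> W1"
    using mem_of_inter_filters_subset[OF assms(1)] inter_sub[of _ W2] assms(3-5) by auto
qed

end
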